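(* Let $T=\{3142,1432,1243\}$ and let $F=F_T(x)=\sum_{n\ge0}|S_n(T)|x^n$. Then $F$ satisfies $$F=1-xF+x\left(2+\frac{x^2}{(1-x)^2}\right)F^2-x^2F^3.$$
   Context: $S_n$ is the set of permutations of $[n]$ ($S_0$ contains the empty permutation). A permutation avoids a pattern $\tau$ if it has no subsequence order-isomorphic to $\tau$; $S_n(T)$ is the set of permutations in $S_n$ avoiding every pattern in $T$. *)

theory Defs
  imports
    "HOL-Library.Sublist"
    "HOL-Combinatorics.Multiset_Permutations"
    "HOL-Computational_Algebra.Formal_Power_Series"
begin

(* A permutation of [n] is represented in one-line notation, as a list containing each of
   1, ..., n exactly once; subseq is the (not necessarily contiguous) subsequence relation. *)

definition order_isomorphic :: "nat list \<Rightarrow> nat list \<Rightarrow> bool" where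
  "order_isomorphic xs ys \<longleftrightarrow> length xs = length ys \<and>
     (\<forall>i<length xs. \<forall>j<length xs. xs ! i < xs ! j \<longleftrightarrow> ys ! i < ys ! j)"

definition avoids :: "nat list \<Rightarrow> nat list \<Rightarrow> bool" where
  "avoids \<pi> \<tau> \<longleftrightarrow> \<not> (\<exists>xs. subseq xs \<pi> \<and> order_isomorphic xs \<tau>)"

definition avoiders :: "nat list set \<Rightarrow> nat \<Rightarrow> nat list set" where
  "avoiders T n = {\<pi> \<in> permutations_of_set {1..n}. \<forall>\<tau>\<in>T. avoids \<pi> \<tau>}"

(* Rational coefficients, so that the quotient by (1 - x)^2 is division of power series. *)
definition avoiders_gf :: "nat list set \<Rightarrow> rat fps" where
  "avoiders_gf T = Abs_fps (\<lambda>n. of_nat (card (avoiders T n)))"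

end

(* Write a permutation as alpha n beta. If alpha > beta entrywise, then alpha and beta are arbitrary
   avoiders: this gives x F^2. Otherwise let m = max beta. The entries of alpha below m decrease
   (1243), precede the entries above m (3142), and the latter increase (1432). So the permutation
   is D E beta with D decreasing of length d >= 1, E increasing of length e >= 1 ending in n, and
   D < m < E. The entries after m are smaller than all the others (3142 and 1432), and they form
   an arbitrary avoider; removing them together with m leaves a permutation D E beta' of the same
   shape, in which possibly D > beta'. For fixed d and e the series C of these permutations thus
   satisfies C = x F (C + x^(d+e) F). Summing over d and e gives
   F = 1 + x F^2 + x^2/(1-x)^2 * x F^2/(1 - x F). *)

theory Submission
  imports Defs "HOL-Library.Infinite_Set"
begin

section \<open>Subsequences of at most four entries in a concatenation\<close>

lemma subseq_append_iff:
  "subseq xs (ys @ zs) \<longleftrightarrow> (\<exists>us vs. xs = us @ vs \<and> subseq us ys \<and> subseq vs zs)"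
  by (blast elim: subseq_appendE intro: list_emb_append_mono)

text \<open>Made for repeated rewriting: either the cut comes before the head or the head joins the
  left part. All cuts of an explicit list are thus enumerated, and a subsequence of
  \<open>xs @ ys\<close> becomes a finite disjunction.\<close>

lemma ex_Cons_eq_append:
  "(\<exists>us vs. x # xs = us @ vs \<and> P us vs) \<longleftrightarrow>
     P [] (x # xs) \<or> (\<exists>us vs. xs = us @ vs \<and> P (x # us) vs)"
  unfolding Cons_eq_append_conv by blast

lemma subseq4_append:
  "subseq [a, b, c, d] (xs @ ys) \<longleftrightarrow>
     subseq [a, b, c, d] ys \<or> a \<in> set xs \<and> subseq [b, c, d] ys \<or>
     subseq [a, b] xs \<and> subseq [c, d] ys \<or> subseq [a, b, c] xs \<and> d \<in> set ys \<or>
     subseq [a, b, c, d] xs"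
  unfolding subseq_append_iff ex_Cons_eq_append by (simp add: subseq_singleton_left)

lemma subseq3_append:
  "subseq [a, b, c] (xs @ ys) \<longleftrightarrow>
     subseq [a, b, c] ys \<or> a \<in> set xs \<and> subseq [b, c] ys \<or>
     subseq [a, b] xs \<and> c \<in> set ys \<or> subseq [a, b, c] xs"
  unfolding subseq_append_iff ex_Cons_eq_append by (simp add: subseq_singleton_left)

lemma subseq2_append:
  "subseq [a, b] (xs @ ys) \<longleftrightarrow>
     subseq [a, b] ys \<or> a \<in> set xs \<and> b \<in> set ys \<or> subseq [a, b] xs"
  unfolding subseq_append_iff ex_Cons_eq_append by (simp add: subseq_singleton_left)

lemma subseq_set_subset: "subseq xs ys \<Longrightarrow> set xs \<subseteq> set ys"
  by (auto dest: list_emb_set)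

text \<open>Brings monotonicity of a block into the language of pattern avoidance, with pairs in the
  role of patterns.\<close>

lemma sorted_wrt_iff_subseq: "sorted_wrt P xs \<longleftrightarrow> (\<forall>x y. subseq [x, y] xs \<longrightarrow> P x y)"
proof (induction xs)
  case (Cons a xs)
  have "subseq [x, y] (a # xs) \<longleftrightarrow> x = a \<and> y \<in> set xs \<or> subseq [x, y] xs" for x y
    by (auto simp: subseq_singleton_left dest: subseq_set_subset)
  then show ?case
    using Cons by auto
qed simp

section \<open>Avoidance of the three patterns and its closure properties\<close>

text \<open>The letters name positions; the excluded orders are 3142, 1432 and 1243 in turn.
  Quantified entries spare later proofs the indices of \<open>order_isomorphic\<close>.\<close>

definition good :: "nat list \<Rightarrow> bool" where
  "good \<pi> \<longleftrightarrow> (\<forall>a b c d. subseq [a, b, c, d] \<pi> \<longrightarrow>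
     \<not> (b < d \<and> d < a \<and> a < c) \<and> \<not> (a < d \<and> d < c \<and> c < b) \<and> \<not> (a < b \<and> b < d \<and> d < c))"

text \<open>Here and in the next lemma the letters name values, so the pattern can be read off from
  the list.\<close>

lemma good_imp_not_3142: "good \<pi> \<Longrightarrow> subseq [c, a, d, b] \<pi> \<Longrightarrow> \<not> (a < b \<and> b < c \<and> c < d)"
  unfolding good_def by blast

lemma good_imp_not_1432: "good \<pi> \<Longrightarrow> subseq [a, d, c, b] \<pi> \<Longrightarrow> \<not> (a < b \<and> b < c \<and> c < d)"
  unfolding good_def by blast

lemma all_less_4:
  "(\<forall>i<Suc (Suc (Suc (Suc 0))). P i) \<longleftrightarrow> P 0 \<and> P (Suc 0) \<and> P (Suc (Suc 0)) \<and> P (Suc (Suc (Suc 0)))"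
  by (auto simp: less_Suc_eq)

lemma order_isomorphic_length4:
  assumes "length ys = 4" "order_isomorphic xs ys"
  obtains a b c d where "xs = [a, b, c, d]"
proof -
  have "length xs = Suc (Suc (Suc (Suc 0)))"
    using assms by (simp add: order_isomorphic_def)
  then show thesis
    using that by (auto simp: length_Suc_conv)
qed

lemma order_isomorphic_patterns:
  "order_isomorphic [a, b, c, d] [3,1,4,2] \<longleftrightarrow> b < d \<and> d < a \<and> a < c"
  "order_isomorphic [a, b, c, d] [1,4,3,2] \<longleftrightarrow> a < d \<and> d < c \<and> c < b"
  "order_isomorphic [a, b, c, d] [1,2,4,3] \<longleftrightarrow> a < b \<and> b < d \<and> d < c"
  by (simp add: order_isomorphic_def all_less_4, linarith)+

lemma good_iff_avoids:
  "good \<pi> \<longleftrightarrow> (\<forall>\<tau>\<in>{[3,1,4,2], [1,4,3,2], [1,2,4,3]}. avoids \<pi> \<tau>)"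
proof -
  have "avoids \<pi> \<tau> \<longleftrightarrow> (\<forall>a b c d. subseq [a, b, c, d] \<pi> \<longrightarrow> \<not> order_isomorphic [a, b, c, d] \<tau>)"
    if "length \<tau> = 4" for \<tau>
    using order_isomorphic_length4[OF that] unfolding avoids_def by metis
  then show ?thesis
    unfolding good_def by (simp add: order_isomorphic_patterns del: One_nat_def) blast
qed

lemma good_subseq: "good ys \<Longrightarrow> subseq xs ys \<Longrightarrow> good xs"
  unfolding good_def by (meson subseq_order.order_trans)

text \<open>None of the three patterns has a proper nonempty prefix whose entries all exceed the
  remaining ones, so no occurrence can straddle the cut.\<close>

lemma good_append_skew:
  assumes "good xs" "good ys" and gt: "\<And>x y. x \<in> set xs \<Longrightarrow> y \<in> set ys \<Longrightarrow> y < x"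
  shows "good (xs @ ys)"
  unfolding good_def
proof (intro allI impI)
  fix a b c d assume "subseq [a, b, c, d] (xs @ ys)"
  then consider "subseq [a, b, c, d] ys" | "a \<in> set xs" "subseq [b, c, d] ys"
    | "subseq [a, b] xs" "subseq [c, d] ys" | "subseq [a, b, c] xs" "d \<in> set ys"
    | "subseq [a, b, c, d] xs"
    unfolding subseq4_append by blast
  then show "\<not> (b < d \<and> d < a \<and> a < c) \<and> \<not> (a < d \<and> d < c \<and> c < b) \<and> \<not> (a < b \<and> b < d \<and> d < c)"
  proof cases
    case 2
    then show ?thesis using gt[of a b] gt[of a c] gt[of a d] subseq_set_subset[OF 2(2)] by auto
  next
    case 3
    then show ?thesis using gt[of a c] gt[of b d] gt[of a d]
        subseq_set_subset[OF 3(1)] subseq_set_subset[OF 3(2)] by auto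
  next
    case 4
    then show ?thesis using gt[of a d] gt[of b d] gt[of c d] subseq_set_subset[OF 4(1)] by auto
  qed (use assms(1,2) in \<open>unfold good_def, blast+\<close>)
qed

text \<open>None of the three patterns ends in its largest entry, so a final maximum takes part in
  no occurrence.\<close>

lemma good_snoc_max:
  assumes "good xs" and lt: "\<And>x. x \<in> set xs \<Longrightarrow> x < n"
  shows "good (xs @ [n])"
  unfolding good_def
proof (intro allI impI)
  fix a b c d assume "subseq [a, b, c, d] (xs @ [n])"
  then consider "subseq [a, b, c] xs" "d = n" | "subseq [a, b, c, d] xs"
    unfolding subseq4_append by (auto split: if_splits)
  then show "\<not> (b < d \<and> d < a \<and> a < c) \<and> \<not> (a < d \<and> d < c \<and> c < b) \<and> \<not> (a < b \<and> b < d \<and> d < c)"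
  proof cases
    case 1
    then show ?thesis using lt[of a] lt[of c] subseq_set_subset[OF 1(1)] by auto
  qed (use assms(1) in \<open>unfold good_def, blast\<close>)
qed

section \<open>Counting over arbitrary finite sets of entries\<close>

text \<open>The condition under which the number of permutations of a finite set with property
  \<open>Q\<close> depends only on the size of the set. An implication suffices, as the inverse of a
  strictly increasing map is again strictly increasing.\<close>

definition order_invariant :: "(nat list \<Rightarrow> bool) \<Rightarrow> bool" where
  "order_invariant Q \<longleftrightarrow> (\<forall>f \<pi>. strict_mono_on (set \<pi>) f \<longrightarrow> Q \<pi> \<longrightarrow> Q (map f \<pi>))"

definition perms :: "(nat list \<Rightarrow> bool) \<Rightarrow> nat set \<Rightarrow> nat list set" where
  "perms Q S = {\<pi> \<in> permutations_of_set S. Q \<pi>}"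

definition count :: "(nat list \<Rightarrow> bool) \<Rightarrow> nat \<Rightarrow> nat" where
  "count Q n = card (perms Q {1..n})"

lemma mem_perms_iff: "\<pi> \<in> perms Q S \<longleftrightarrow> set \<pi> = S \<and> distinct \<pi> \<and> Q \<pi>"
  by (auto simp: perms_def permutations_of_set_def)

lemma finite_perms [simp]: "finite (perms Q S)"
  by (cases "finite S") (simp_all add: perms_def)

text \<open>Relabelling along the increasing bijection \<open>h\<close> from
  \<open>{1..card S}\<close> to \<open>S\<close> matches the two sets of permutations;
  \<open>g\<close> is its inverse.\<close>

lemma card_perms:
  assumes Q: "order_invariant Q" and S: "finite S"
  shows "card (perms Q S) = count Q (card S)"
proof -
  obtain h' where h': "bij_betw h' {..<card S} S" "strict_mono_on {..<card S} h'"
    using ex_bij_betw_strict_mono_card[OF S] by blast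
  \<comment> \<open>The domain of \<open>h'\<close> starts at 0, that of \<open>h\<close> at
    1.\<close>
  define h where "h = h' \<circ> (\<lambda>i. i - 1)"
  have "bij_betw (\<lambda>i::nat. i - 1) {1..card S} {..<card S}"
    by (rule bij_betw_byWitness[where f' = Suc]) auto
  then have h: "bij_betw h {1..card S} S" "strict_mono_on {1..card S} h"
    using h' by (auto simp: h_def bij_betw_trans intro!: strict_mono_onI elim!: strict_mono_onD)
  define g where "g = inv_into {1..card S} h"
  have inj: "inj_on h {1..card S}" and im: "h ` {1..card S} = S"
    using h(1) by (auto simp: bij_betw_def)
  have g: "strict_mono_on S g"
  proof (rule strict_mono_onI)
    fix x y assume "x \<in> S" "y \<in> S" "x < y"
    then obtain i j where "x = h i" "y = h j" "i \<in> {1..card S}" "j \<in> {1..card S}"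
      using im by blast
    moreover from this have "i < j"
      using h(2) \<open>x < y\<close> by (metis linorder_neqE_nat order_less_asym strict_mono_onD)
    ultimately show "g x < g y"
      using inj by (simp add: g_def)
  qed
  have gS: "g ` S = {1..card S}"
    using inv_into_image_cancel[OF inj order_refl] by (metis g_def im)
  have hg: "map h (map g \<pi>) = \<pi>" if "set \<pi> = S" for \<pi>
    using that im by (auto simp: g_def f_inv_into_f intro!: map_idI)
  have "perms Q S = map h ` perms Q {1..card S}"
  proof (intro Set.set_eqI iffI)
    fix \<pi> assume "\<pi> \<in> perms Q S"
    then have \<pi>: "set \<pi> = S" "distinct \<pi>" "Q \<pi>"
      by (auto simp: mem_perms_iff)
    have "map g \<pi> \<in> perms Q {1..card S}"
      using \<pi> g Q gS strict_mono_on_imp_inj_on[OF g]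
      by (simp add: mem_perms_iff distinct_map order_invariant_def)
    then show "\<pi> \<in> map h ` perms Q {1..card S}"
      using hg[OF \<pi>(1)] by (metis imageI)
  next
    fix \<pi> assume "\<pi> \<in> map h ` perms Q {1..card S}"
    then show "\<pi> \<in> perms Q S"
      using Q h(2) inj im by (auto simp: mem_perms_iff distinct_map order_invariant_def)
  qed
  moreover have "inj_on (map h) (perms Q {1..card S})"
    using inj by (intro inj_onI) (metis mem_perms_iff map_inj_on Un_absorb)
  ultimately show ?thesis
    by (simp add: card_image count_def)
qed

text \<open>As b occurs in neither part, it marks the cut, and l is recovered as the length of
  \<beta>. Used with b = n for all avoiders and with b = n - e for crossed permutations.\<close>

lemma card_join_perms:
  assumes "finite I" "\<And>l. l \<in> I \<Longrightarrow> finite (V l) \<and> b \<notin> U l \<and> b \<notin> V l \<and> card (V l) = l"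
  shows "card ((\<lambda>(l, \<alpha>, \<beta>). \<alpha> @ b # \<beta>) ` Sigma I (\<lambda>l. perms P (U l) \<times> perms Q (V l)))
       = (\<Sum>l\<in>I. card (perms P (U l)) * card (perms Q (V l)))"
proof -
  have "inj_on (\<lambda>(l, \<alpha>, \<beta>). \<alpha> @ b # \<beta>) (Sigma I (\<lambda>l. perms P (U l) \<times> perms Q (V l)))"
  proof (rule inj_onI, clarsimp)
    fix l \<alpha> \<beta> l' \<alpha>' \<beta>'
    assume *: "\<alpha> @ b # \<beta> = \<alpha>' @ b # \<beta>'"
      "l \<in> I" "\<alpha> \<in> perms P (U l)" "\<beta> \<in> perms Q (V l)"
      "l' \<in> I" "\<alpha>' \<in> perms P (U l')" "\<beta>' \<in> perms Q (V l')"
    then have "\<alpha> = \<alpha>' \<and> \<beta> = \<beta>'"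
      using assms(2)[of l] assms(2)[of l'] append_Cons_eq_iff[of b \<alpha> \<beta> \<alpha>' \<beta>']
      by (auto simp: mem_perms_iff)
    moreover have "l = length \<beta>" "l' = length \<beta>'"
      using * assms(2) distinct_card[of \<beta>] distinct_card[of \<beta>'] by (auto simp: mem_perms_iff)
    ultimately show "l = l' \<and> \<alpha> = \<alpha>' \<and> \<beta> = \<beta>'" by simp
  qed
  then show ?thesis
    using assms(1) by (simp add: card_image card_cartesian_product)
qed

text \<open>A subsequence of \<open>map f \<pi>\<close> is the image of the entries of \<pi> at the
  same positions \<open>N\<close>, and these have the same relative order.\<close>

lemma order_invariant_good: "order_invariant good"
  unfolding order_invariant_def good_def
proof (intro allI impI)
  fix f :: "nat \<Rightarrow> nat" and \<pi> a b c d
  assume f: "strict_mono_on (set \<pi>) f" and sub: "subseq [a, b, c, d] (map f \<pi>)"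
    and good: "\<forall>a b c d. subseq [a, b, c, d] \<pi> \<longrightarrow>
     \<not> (b < d \<and> d < a \<and> a < c) \<and> \<not> (a < d \<and> d < c \<and> c < b) \<and> \<not> (a < b \<and> b < d \<and> d < c)"
  obtain N where N: "[a, b, c, d] = map f (nths \<pi> N)"
    using sub unfolding subseq_conv_nths nths_map by (elim exE) (rule that)
  have "subseq (nths \<pi> N) \<pi>"
    unfolding subseq_conv_nths by blast
  moreover obtain a' b' c' d' where *: "nths \<pi> N = [a', b', c', d']" "a = f a'" "b = f b'" "c = f c'" "d = f d'"
    using N by (auto simp: Cons_eq_map_conv)
  ultimately have sub': "subseq [a', b', c', d'] \<pi>"
    by simp
  have less: "f x < f y \<longleftrightarrow> x < y" if "x \<in> set \<pi>" "y \<in> set \<pi>" for x y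
    using f that by (metis linorder_neqE_nat order_less_asym strict_mono_onD)
  have "a' \<in> set \<pi>" "b' \<in> set \<pi>" "c' \<in> set \<pi>" "d' \<in> set \<pi>"
    using subseq_set_subset[OF sub'] by auto
  moreover have "\<not> (b' < d' \<and> d' < a' \<and> a' < c') \<and> \<not> (a' < d' \<and> d' < c' \<and> c' < b')
      \<and> \<not> (a' < b' \<and> b' < d' \<and> d' < c')"
    using good sub' by blast
  ultimately show "\<not> (b < d \<and> d < a \<and> a < c) \<and> \<not> (a < d \<and> d < c \<and> c < b) \<and> \<not> (a < b \<and> b < d \<and> d < c)"
    unfolding *(2-) by (simp add: less)
qed

section \<open>Structure of the avoiders\<close>

lemma subseq2_distinct: "distinct xs \<Longrightarrow> subseq [x, y] xs \<Longrightarrow> x \<noteq> y"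
  by (induction xs) (auto simp: subseq_singleton_left split: if_splits)

lemma sorted_wrt_subseq: "sorted_wrt P ys \<Longrightarrow> subseq xs ys \<Longrightarrow> sorted_wrt P xs"
  unfolding sorted_wrt_iff_subseq by (meson subseq_order.order_trans)

text \<open>The difference between \<open>tented\<close> and \<open>crossed\<close> is that the former
  also allows D > \<beta>.\<close>

definition tent :: "nat list \<Rightarrow> nat list \<Rightarrow> nat list \<Rightarrow> bool" where
  "tent D E \<beta> \<longleftrightarrow> sorted_wrt (>) D \<and> sorted_wrt (<) E \<and>
     (\<forall>y\<in>set E. \<forall>x\<in>set D \<union> set \<beta>. x < y)"

definition tented :: "nat \<Rightarrow> nat \<Rightarrow> nat list \<Rightarrow> bool" where
  "tented d e \<pi> \<longleftrightarrow> good \<pi> \<and> (\<exists>D E \<beta>. \<pi> = D @ E @ \<beta> \<and> length D = d \<and> length E = e \<and> tent D E \<beta>)"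

definition crossed :: "nat \<Rightarrow> nat \<Rightarrow> nat list \<Rightarrow> bool" where
  "crossed d e \<pi> \<longleftrightarrow> good \<pi> \<and> (\<exists>D E \<beta>. \<pi> = D @ E @ \<beta> \<and> length D = d \<and> length E = e \<and> tent D E \<beta> \<and>
     (\<exists>y\<in>set \<beta>. \<forall>x\<in>set D. x < y))"

lemma tentedI:
  "good (D @ E @ \<beta>) \<Longrightarrow> tent D E \<beta> \<Longrightarrow> tented (length D) (length E) (D @ E @ \<beta>)"
  unfolding tented_def by blast

lemma crossedI:
  "good (D @ E @ \<beta>) \<Longrightarrow> tent D E \<beta> \<Longrightarrow> y \<in> set \<beta> \<Longrightarrow> (\<And>x. x \<in> set D \<Longrightarrow> x < y) \<Longrightarrow>
     crossed (length D) (length E) (D @ E @ \<beta>)"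
  unfolding crossed_def by blast

lemma order_invariant_tented: "order_invariant (tented d e)"
  unfolding order_invariant_def
proof (intro allI impI)
  fix f :: "nat \<Rightarrow> nat" and \<pi> assume f: "strict_mono_on (set \<pi>) f" and "tented d e \<pi>"
  then obtain D E \<beta> where *: "good \<pi>" "\<pi> = D @ E @ \<beta>" "length D = d" "length E = e" "tent D E \<beta>"
    by (auto simp: tented_def)
  have "good (map f \<pi>)"
    using order_invariant_good f *(1) by (auto simp: order_invariant_def)
  moreover have "tent (map f D) (map f E) (map f \<beta>)"
    using f *(5) unfolding *(2) tent_def sorted_wrt_map
    by (auto simp: strict_mono_on_def elim!: sorted_wrt_mono_rel[rotated])
  ultimately show "tented d e (map f \<pi>)"
    using *(2-4) unfolding tented_def by (metis length_map map_append)
qed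

text \<open>An x in A but not in A' would come with a y in A' but not in A, by equal sizes. Then x
  lies in B' and y in B, so both x < y and y < x. This turns comparisons between blocks of known
  size into explicit intervals of entries.\<close>

lemma top_part_unique:
  fixes A B :: "'a :: linorder set"
  assumes "A \<union> B = A' \<union> B'" "finite A" "finite A'" "card A = card A'"
    "\<And>x y. x \<in> A \<Longrightarrow> y \<in> B \<Longrightarrow> y < x" "\<And>x y. x \<in> A' \<Longrightarrow> y \<in> B' \<Longrightarrow> y < x"
  shows "A = A'" and "B = B'"
proof -
  have "A \<subseteq> A'"
  proof (rule ccontr)
    assume "\<not> A \<subseteq> A'"
    then obtain x where x: "x \<in> A" "x \<notin> A'" by blast
    have "\<not> A' \<subseteq> A"
      using x assms(2,4) by (metis card_subset_eq)
    then obtain y where "y \<in> A'" "y \<notin> A" by blast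
    then show False
      using x assms(1,5,6) by (metis UnE UnI1 order_less_asym)
  qed
  then show "A = A'"
    using assms(3,4) by (simp add: card_subset_eq)
  then show "B = B'"
    using assms(1,5,6) by (metis (no_types, lifting) UnE UnI2 order_less_irrefl subsetI subset_antisym)
qed

text \<open>Each pattern has an entry that exceeds both some earlier and some later one, whereas
  \<open>D @ E\<close> first falls and then rises.\<close>

lemma good_desc_asc:
  assumes "tent D E []"
  shows "good (D @ E)"
  unfolding good_def
proof (intro allI impI)
  have D: "sorted_wrt (>) xs" if "subseq xs D" for xs
    using assms sorted_wrt_subseq[OF _ that] by (auto simp: tent_def)
  have E: "sorted_wrt (<) xs" if "subseq xs E" for xs
    using assms sorted_wrt_subseq[OF _ that] by (auto simp: tent_def)
  have DE: "x < y" if "x \<in> set D" "y \<in> set E" for x y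
    using assms that by (auto simp: tent_def)
  fix a b c d assume "subseq [a, b, c, d] (D @ E)"
  then consider "subseq [a, b, c, d] E" | "a \<in> set D" "subseq [b, c, d] E"
    | "subseq [a, b] D" "subseq [c, d] E" | "subseq [a, b, c] D" "d \<in> set E"
    | "subseq [a, b, c, d] D"
    unfolding subseq4_append by blast
  then show "\<not> (b < d \<and> d < a \<and> a < c) \<and> \<not> (a < d \<and> d < c \<and> c < b) \<and> \<not> (a < b \<and> b < d \<and> d < c)"
  proof cases
    case 2
    then show ?thesis using E[OF 2(2)] DE[of a d] subseq_set_subset[OF 2(2)] by auto
  next
    case 3
    then show ?thesis using D[OF 3(1)] E[OF 3(2)] by auto
  next
    case 4
    then show ?thesis using D[OF 4(1)] DE[of c d] subseq_set_subset[OF 4(1)] by auto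
  qed (use D[of "[a, b, c, d]"] E[of "[a, b, c, d]"] in auto)
qed

text \<open>In an occurrence ending in m, the letters above the last one lie in E and the others in
  D or \<beta>. For 3142 the 1 would lie between two entries of the contiguous block E; for 1432 the
  entries 4, 3 would descend in E; for 1243 the entries 1, 2 would ascend in D.\<close>

lemma good_tent_snoc:
  assumes "good (D @ E @ \<beta>)" and tent: "tent D E (\<beta> @ [m])"
    and m: "\<And>x. x \<in> set D \<union> set \<beta> \<Longrightarrow> x < m"
  shows "good (D @ E @ \<beta> @ [m])"
  unfolding good_def
proof (intro allI impI)
  fix p q r s assume "subseq [p, q, r, s] (D @ E @ \<beta> @ [m])"
  then consider "subseq [p, q, r] (D @ E @ \<beta>)" "s = m" | "subseq [p, q, r, s] (D @ E @ \<beta>)"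
    using subseq4_append[of p q r s "D @ E @ \<beta>" "[m]"] by (auto split: if_splits)
  then show "\<not> (q < s \<and> s < p \<and> p < r) \<and> \<not> (p < s \<and> s < r \<and> r < q) \<and> \<not> (p < q \<and> q < s \<and> s < r)"
  proof cases
    case 1
    have E: "m < y" if "y \<in> set E" for y
      using that tent by (auto simp: tent_def)
    have sub: "p \<in> set xs \<and> q \<in> set xs \<and> r \<in> set xs" if "subseq [p, q, r] xs" for xs
      using subseq_set_subset[OF that] by auto
    have sub2: "x \<in> set xs \<and> y \<in> set xs" if "subseq [x, y] xs" for x y and xs :: "nat list"
      using subseq_set_subset[OF that] by auto
    \<comment> \<open>The distributions of the first three letters over D, E and \<beta>, coarsened
      to what each contradiction needs.\<close>
    have "subseq [p, q, r] D \<or> subseq [p, q, r] E \<or> subseq [p, q, r] \<beta> \<or>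
      subseq [p, q] D \<or> p \<in> set D \<and> subseq [q, r] E \<or> q \<in> set E \<and> r \<in> set \<beta> \<or> q \<in> set \<beta> \<and> r \<in> set \<beta>"
      using 1(1) sub2[of p q E] sub2[of q r \<beta>]
      unfolding subseq3_append[of p q r D] subseq3_append[of p q r E] subseq2_append[of q r E]
      by blast
    then consider "subseq [p, q, r] D" | "subseq [p, q, r] E" | "subseq [p, q, r] \<beta>"
      | "subseq [p, q] D" | "p \<in> set D" "subseq [q, r] E"
      | "q \<in> set E" "r \<in> set \<beta>" | "q \<in> set \<beta>" "r \<in> set \<beta>"
      by blast
    then show ?thesis
    proof cases
      case 1
      then show ?thesis using m[of p] m[of q] m[of r] \<open>s = m\<close> sub[OF 1] by auto
    next
      case 2
      then have "sorted_wrt (<) [p, q, r]"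
        using tent sorted_wrt_subseq[OF _ 2] by (auto simp: tent_def)
      then show ?thesis using E[of p] E[of q] E[of r] \<open>s = m\<close> sub[OF 2] by auto
    next
      case 3
      then show ?thesis using m[of p] m[of q] m[of r] \<open>s = m\<close> sub[OF 3] by auto
    next
      case 4
      then have "sorted_wrt (>) [p, q]"
        using tent sorted_wrt_subseq[OF _ 4] by (auto simp: tent_def)
      then show ?thesis using m[of p] m[of q] \<open>s = m\<close> sub2[OF 4] by auto
    next
      case 5
      then have "sorted_wrt (<) [q, r]"
        using tent sorted_wrt_subseq[OF _ 5(2)] by (auto simp: tent_def)
      then show ?thesis using 5 m[of p] E[of q] E[of r] \<open>s = m\<close> sub2[OF 5(2)] by auto
    qed (use m[of r] m[of q] E[of q] \<open>s = m\<close> in auto)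
  qed (use assms(1) in \<open>unfold good_def, blast\<close>)
qed

section \<open>Shape of an avoider with an entry before n below an entry after n\<close>

lemma good_crossing_decomposition:
  assumes good: "good (\<alpha> @ n # \<beta>)" and dist: "distinct (\<alpha> @ n # \<beta>)"
    and n: "\<And>x. x \<in> set \<alpha> \<union> set \<beta> \<Longrightarrow> x < n"
    and ab: "a \<in> set \<alpha>" "b \<in> set \<beta>" "a < b"
  obtains d e where "1 \<le> d" "1 \<le> e" "d + e \<le> length (\<alpha> @ n # \<beta>)" "crossed d e (\<alpha> @ n # \<beta>)"
proof -
  define m where "m = Max (set \<beta>)"
  have m: "m \<in> set \<beta>" "b \<le> m" "\<And>y. y \<in> set \<beta> \<Longrightarrow> y \<le> m"
    using ab(2) by (auto simp: m_def intro: Max_in)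
  \<comment> \<open>D is the longest prefix of \<alpha> below m. That all of the remainder C lies
    above m has yet to be derived.\<close>
  define D where "D = takeWhile (\<lambda>x. x < m) \<alpha>"
  define C where "C = dropWhile (\<lambda>x. x < m) \<alpha>"
  have \<alpha>: "\<alpha> = D @ C"
    by (simp add: C_def D_def)
  have D: "x < m" if "x \<in> set D" for x
    using that by (auto simp: D_def dest: set_takeWhileD)
  \<comment> \<open>The entries n, m supply the last two letters of a 3142 or a 1243 that begins
    with x, y.\<close>
  have sub: "subseq [x, y, n, m] (\<alpha> @ n # \<beta>)" if "subseq [x, y] \<alpha>" for x y
    using that m(1) unfolding subseq4_append by (auto simp: subseq_singleton_left)
  \<comment> \<open>The first entry c of C is above m. A later entry x of C below m would make c, x,
    n, m a 3142.\<close>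
  have C: "m < x" if x: "x \<in> set C" for x
  proof (rule ccontr)
    assume "\<not> m < x"
    obtain c C' where C': "C = c # C'"
      using x by (cases C) auto
    then have "\<not> c < m"
      using hd_dropWhile[of "\<lambda>x. x < m" \<alpha>] by (simp add: C_def)
    moreover have "x \<noteq> m" "c \<noteq> m" and cn: "c < n"
      using x m(1) dist n by (auto simp: \<alpha> C')
    ultimately have "x < m" "m < c"
      using \<open>\<not> m < x\<close> by auto
    moreover from this have "x \<in> set C'"
      using x by (auto simp: C')
    then have "subseq [c, x] \<alpha>"
      unfolding \<alpha> C' by (intro subseq_drop_many) (simp add: subseq_singleton_left)
    ultimately show False
      using sub[of c x] good cn unfolding good_def by blast
  qed
  have "\<not> m < a"
    using m(2) ab(3) by simp
  then have aD: "a \<in> set D"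
    using ab(1) C[of a] by (auto simp: \<alpha>)
  have "sorted_wrt (>) D"
    unfolding sorted_wrt_iff_subseq
  proof (intro allI impI)
    fix x y assume xy: "subseq [x, y] D"
    then have "subseq [x, y] \<alpha>" by (simp add: \<alpha> subseq_rev_drop_many)
    moreover have "x \<noteq> y"
      using dist subseq2_distinct[OF _ xy] by (simp add: \<alpha>)
    moreover have "y < m" "m < n"
      using D subseq_set_subset[OF xy] m(1) n by auto
    ultimately show "y < x"
      using sub[of x y] good unfolding good_def by (metis linorder_neqE_nat)
  qed
  moreover have "sorted_wrt (<) C"
    unfolding sorted_wrt_iff_subseq
  proof (intro allI impI)
    fix x y assume xy: "subseq [x, y] C"
    \<comment> \<open>A descent x, y in C would form a 1432 with a from D in front and m
      behind.\<close>
    then have "subseq [a, x, y, m] (\<alpha> @ n # \<beta>)"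
      using aD m(1) unfolding \<alpha> append_assoc subseq4_append[of _ _ _ _ D]
      unfolding subseq_append_iff ex_Cons_eq_append by (auto simp: subseq_singleton_left)
    moreover have "x \<noteq> y"
      using dist subseq2_distinct[OF _ xy] by (simp add: \<alpha>)
    moreover have "a < m" "m < y"
      using D[OF aD] C[of y] subseq_set_subset[OF xy] by auto
    ultimately show "x < y"
      using good unfolding good_def by (metis linorder_neqE_nat)
  qed
  \<comment> \<open>The increasing block E is C followed by n, hence nonempty even if C is
    empty.\<close>
  ultimately have "tent D (C @ [n]) \<beta>"
    using n C D m(3) unfolding tent_def sorted_wrt_append by (fastforce simp: \<alpha>)
  moreover have "\<exists>y\<in>set \<beta>. \<forall>x\<in>set D. x < y"
    using m(1) D by blast
  moreover have "\<alpha> @ n # \<beta> = D @ (C @ [n]) @ \<beta>"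
    by (simp add: \<alpha>)
  ultimately have "crossed (length D) (length (C @ [n])) (\<alpha> @ n # \<beta>)"
    using good unfolding crossed_def by metis
  moreover have "1 \<le> length D"
    using aD by (cases D) auto
  ultimately show thesis
    by (rule that[rotated 3]) (auto simp: \<alpha>)
qed

section \<open>Recursion for crossed and tented permutations\<close>

text \<open>If z > y, then z precedes x in the decreasing block D, and z, x, \<open>last E\<close>,
  y is a 3142. Hence either D exceeds \<beta> entrywise or some entry of \<beta> exceeds all of
  D.\<close>

lemma crossing_above:
  assumes "good (D @ E @ \<beta>)" "distinct (D @ E @ \<beta>)" "tent D E \<beta>" "E \<noteq> []"
    and xy: "x \<in> set D" "y \<in> set \<beta>" "x < y" and z: "z \<in> set D"
  shows "z < y"
proof (rule ccontr)
  assume "\<not> z < y"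
  moreover have "z \<noteq> y"
    using assms(2) xy(2) z by auto
  ultimately have "y < z" by simp
  obtain D1 D2 where D: "D = D1 @ x # D2"
    using xy(1) by (meson split_list)
  moreover have "sorted_wrt (>) D"
    using assms(3) by (simp add: tent_def)
  ultimately have "z \<in> set D1"
    using z \<open>y < z\<close> xy(3) by (auto simp: sorted_wrt_append)
  then have "subseq [z, x] D"
    unfolding D by (simp add: subseq2_append)
  moreover have "subseq [last E, y] (E @ \<beta>)"
    using assms(4) xy(2) by (simp add: subseq2_append)
  ultimately have "subseq [z, x, last E, y] (D @ E @ \<beta>)"
    by (simp add: subseq4_append)
  moreover have "z < last E"
    using assms(3,4) z by (auto simp: tent_def)
  ultimately show False
    using good_imp_not_3142[OF assms(1)] \<open>y < z\<close> xy(3) by blast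
qed

text \<open>An application of \<open>top_part_unique\<close> to E and the rest. \<open>S\<close> is
  kept general because in \<open>crossed_join\<close> it lacks n - e and the entries up to
  l.\<close>

lemma tent_top:
  assumes "set (D @ E @ \<beta>) = S" "distinct (D @ E @ \<beta>)" "tent D E \<beta>" "length E \<le> n"
    and "{n - length E + 1..n} \<subseteq> S" "S \<subseteq> {..n}"
  shows "set E = {n - length E + 1..n}" "set D \<union> set \<beta> = S - {n - length E + 1..n}"
proof -
  have "set E \<union> (set D \<union> set \<beta>) = {n - length E + 1..n} \<union> (S - {n - length E + 1..n})"
    using assms(1,5) by auto
  moreover have "card (set E) = card {n - length E + 1..n}"
    using assms(2,4) by (simp add: distinct_card)
  moreover have "y < x" if "x \<in> set E" "y \<in> set D \<union> set \<beta>" for x y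
    using assms(3) that by (auto simp: tent_def)
  moreover have "y < x" if "x \<in> {n - length E + 1..n}" "y \<in> S - {n - length E + 1..n}" for x y
    using that assms(6) by (auto simp: not_le)
  ultimately show "set E = {n - length E + 1..n}" "set D \<union> set \<beta> = S - {n - length E + 1..n}"
    using top_part_unique[of "set E" "set D \<union> set \<beta>" "{n - length E + 1..n}" "S - {n - length E + 1..n}"]
    by blast+
qed

text \<open>\<open>good_tent_snoc\<close> admits n - e, and \<open>good_append_skew\<close> admits
  L, which lies below everything else. The result is crossed even if \<pi> is merely tented, since n
  - e exceeds all of D.\<close>

lemma crossed_join:
  assumes l: "l < n - e" and \<pi>: "\<pi> \<in> perms (tented d e) ({l + 1..n} - {n - e})" and L: "L \<in> perms good {1..l}"
  shows "\<pi> @ (n - e) # L \<in> perms (crossed d e) {1..n}"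
proof -
  obtain D E \<beta> where *: "good \<pi>" "\<pi> = D @ E @ \<beta>" "length D = d" "length E = e" "tent D E \<beta>"
    using \<pi> by (auto simp: mem_perms_iff tented_def)
  have set\<pi>: "set \<pi> = {l + 1..n} - {n - e}" and dist: "distinct \<pi>"
    using \<pi> by (auto simp: mem_perms_iff)
  have setL: "set L = {1..l}" "distinct L" "good L"
    using L by (auto simp: mem_perms_iff)
  have top: "e \<le> n" "{n - e + 1..n} \<subseteq> {l + 1..n} - {n - e}" "{l + 1..n} - {n - e} \<subseteq> {..n}"
    using l by auto
  have E: "set E = {n - e + 1..n}" and DB: "set D \<union> set \<beta> = ({l + 1..n} - {n - e}) - {n - e + 1..n}"
    using tent_top[OF set\<pi>[unfolded *(2)] dist[unfolded *(2)] *(5), unfolded *(4), OF top] .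
  have DB_less: "x < n - e" if "x \<in> set D \<union> set \<beta>" for x
    using that unfolding DB by auto
  have tent': "tent D E (\<beta> @ [n - e])"
    using *(5) E by (auto simp: tent_def)
  then have "good (D @ E @ \<beta> @ [n - e])"
    by (rule good_tent_snoc[OF *(1)[unfolded *(2)] _ DB_less])
  moreover have "y < x" if "x \<in> set (D @ E @ \<beta> @ [n - e])" "y \<in> set L" for x y
  proof -
    have "x \<in> set \<pi> \<or> x = n - e"
      using that(1) by (auto simp: *(2))
    then show ?thesis
      using that(2) l by (auto simp: set\<pi> setL)
  qed
  ultimately have "good ((D @ E @ \<beta> @ [n - e]) @ L)"
    using good_append_skew[of "D @ E @ \<beta> @ [n - e]" L] setL(3) by blast
  moreover have "tent D E (\<beta> @ (n - e) # L)"
    using tent' E setL l by (auto simp: tent_def)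
  ultimately have "crossed d e (\<pi> @ (n - e) # L)"
    using crossedI[of D E "\<beta> @ (n - e) # L" "n - e"] DB_less by (simp add: *)
  moreover have "set (\<pi> @ (n - e) # L) = {1..n}"
    using l by (auto simp: set\<pi> setL)
  moreover have "distinct (\<pi> @ (n - e) # L)"
    using dist setL l by (auto simp: set\<pi>)
  ultimately show ?thesis
    by (simp add: mem_perms_iff)
qed

text \<open>The split point \<open>n - e\<close> is the maximum of \<beta>: exactly the e entries of E exceed it. It is thus
  known in advance, so that no relabelling is needed when it is removed.\<close>

lemma crossed_split:
  assumes "\<pi> \<in> perms (crossed d e) {1..n}" and d: "1 \<le> d" and e: "1 \<le> e"
  obtains l \<pi>' L where "l < n - e" "\<pi> = \<pi>' @ (n - e) # L"
    "\<pi>' \<in> perms (tented d e) ({l + 1..n} - {n - e})" "L \<in> perms good {1..l}"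
proof -
  obtain D E \<beta> y where *: "good \<pi>" "\<pi> = D @ E @ \<beta>" "length D = d" "length E = e" "tent D E \<beta>"
    "y \<in> set \<beta>" "\<forall>x\<in>set D. x < y" and set\<pi>: "set \<pi> = {1..n}" and dist: "distinct \<pi>"
    using assms(1) by (auto simp: mem_perms_iff crossed_def)
  define m where "m = Max (set \<beta>)"
  have m: "m \<in> set \<beta>" "\<And>x. x \<in> set \<beta> \<Longrightarrow> x \<le> m"
    using *(6) by (auto simp: m_def intro: Max_in)
  have Dm: "x < m" if "x \<in> set D" for x
    using m(2)[OF *(6)] *(7) that by auto
  have "length \<pi> = n"
    using set\<pi> dist distinct_card by fastforce
  then have top: "e \<le> n" "{n - e + 1..n} \<subseteq> {1..n}" "{1..n} \<subseteq> {..n}"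
    using * by auto
  have E: "set E = {n - e + 1..n}" and DB: "set D \<union> set \<beta> = {1..n} - {n - e + 1..n}"
    using tent_top[OF set\<pi>[unfolded *(2)] dist[unfolded *(2)] *(5), unfolded *(4), OF top] .
  have "m \<in> {1..n} - {n - e + 1..n}"
    using m(1) DB by blast
  \<comment> \<open>n - e is the largest entry outside E, and m bounds every entry outside
    E.\<close>
  then have "n - e \<in> set D \<union> set \<beta>" "m \<le> n - e"
    unfolding DB by auto
  then have m_eq: "m = n - e"
    using m(2) Dm by (metis Un_iff le_antisym less_imp_le)
  obtain \<beta>1 L where \<beta>: "\<beta> = \<beta>1 @ m # L"
    using m(1) by (meson split_list)
  obtain x where x: "x \<in> set D"
    using *(3) d by (cases D) auto
  obtain n' where n': "n' \<in> set E"
    using *(4) e by (cases E) auto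
  have "m < n'"
    using *(5) n' m(1) by (auto simp: tent_def)
  have less: "y < z" if y: "y \<in> set L" and z: "z \<in> set D \<union> set E \<union> set \<beta>1 \<union> {m}" for y z
  proof -
    have "y \<noteq> m" "y \<noteq> z" "y \<le> m"
      using dist y z m(2) unfolding *(2) \<beta> by auto
    then have "y < m" by simp
    consider "z \<in> set D" | "z \<in> set E" | "z \<in> set \<beta>1" | "z = m"
      using z by blast
    then show ?thesis
    proof cases
      case 1
      \<comment> \<open>With z < y this would be a 1432.\<close>
      have "subseq [z, n', m, y] \<pi>"
        unfolding *(2) \<beta> using 1 n' y
        by (simp add: subseq4_append[of _ _ _ _ D] subseq3_append[of _ _ _ E] subseq2_append subseq_singleton_left)
      then show ?thesis
        using good_imp_not_1432[OF *(1)] \<open>m < n'\<close> \<open>y < m\<close> \<open>y \<noteq> z\<close> by (meson linorder_neqE_nat)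
    next
      case 2
      then show ?thesis
        using *(5) y by (auto simp: tent_def \<beta>)
    next
      case 3
      \<comment> \<open>The 1432 excluded below forces y < x; then z < y would make x, z, m, y a
        3142.\<close>
      have "subseq [x, z, m, y] \<pi>"
        unfolding *(2) \<beta> using 3 x y
        by (simp add: subseq4_append[of _ _ _ _ D] subseq3_append[of _ _ _ E] subseq3_append[of _ _ _ \<beta>1] subseq_singleton_left)
      moreover have "subseq [x, n', m, y] \<pi>"
        unfolding *(2) \<beta> using n' x y
        by (simp add: subseq4_append[of _ _ _ _ D] subseq3_append[of _ _ _ E] subseq2_append subseq_singleton_left)
      then have "\<not> x < y"
        using good_imp_not_1432[OF *(1)] \<open>m < n'\<close> \<open>y < m\<close> by blast
      moreover have "x \<noteq> y" "x < m"
        using dist x y Dm unfolding *(2) \<beta> by auto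
      ultimately show ?thesis
        using good_imp_not_3142[OF *(1)] \<open>y < m\<close> \<open>y \<noteq> z\<close> by (meson linorder_neqE_nat)
    next
      case 4
      with \<open>y < m\<close> show ?thesis by simp
    qed
  qed
  define l where "l = length L"
  have "distinct L" "set L \<subseteq> {1..n}"
    using dist set\<pi> by (auto simp: *(2) \<beta>)
  then have "card (set L) = l" "l \<le> n"
    using card_mono[of "{1..n}" "set L"] by (auto simp: l_def distinct_card)
  \<comment> \<open>The entries up to and including m. They exceed all of L, so the sizes alone
    determine both sets.\<close>
  define R where "R = set D \<union> set E \<union> set \<beta>1 \<union> {m}"
  have RL: "R \<union> set L = {1..n}" "R \<inter> set L = {}"
    using set\<pi> dist by (auto simp: R_def *(2) \<beta>)
  have "card R = n - l"
    using RL \<open>card (set L) = l\<close> card_Un_disjoint[of R "set L"] by (simp add: R_def)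
  then have R0: "R \<union> set L = {l + 1..n} \<union> {1..l}" "finite R" "card R = card {l + 1..n}"
    "\<And>x y. x \<in> R \<Longrightarrow> y \<in> set L \<Longrightarrow> y < x"
    using RL(1) less \<open>l \<le> n\<close> by (auto simp: R_def)
  have R: "R = {l + 1..n}" and L: "set L = {1..l}"
    using top_part_unique[OF R0(1,2) finite_atLeastAtMost R0(3,4)] by simp_all
  have "m \<in> R"
    by (simp add: R_def)
  then have "l < n - e"
    unfolding R using m_eq by simp
  have "subseq (D @ E @ \<beta>1) ((D @ E @ \<beta>1) @ m # L)" "subseq L ((D @ E @ \<beta>1 @ [m]) @ L)"
    by (intro subseq_rev_drop_many subseq_drop_many subseq_order.order_refl)+
  then have "good (D @ E @ \<beta>1)" "good L"
    using good_subseq[OF *(1)] by (simp_all add: *(2) \<beta>)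
  moreover have "tent D E \<beta>1"
    using *(5) by (auto simp: tent_def \<beta>)
  ultimately have "tented d e (D @ E @ \<beta>1)"
    using tentedI *(3,4) by blast
  moreover have "set (D @ E @ \<beta>1) = {l + 1..n} - {n - e}"
    using dist unfolding R[symmetric] m_eq[symmetric] R_def *(2) \<beta> by auto
  moreover have "distinct (D @ E @ \<beta>1)"
    using dist by (auto simp: *(2) \<beta>)
  ultimately have "D @ E @ \<beta>1 \<in> perms (tented d e) ({l + 1..n} - {n - e})"
    by (simp add: mem_perms_iff)
  moreover have "L \<in> perms good {1..l}"
    using \<open>good L\<close> \<open>distinct L\<close> L by (simp add: mem_perms_iff)
  moreover have "\<pi> = (D @ E @ \<beta>1) @ (n - e) # L"
    by (simp add: *(2) \<beta> m_eq)
  ultimately show thesis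
    using \<open>l < n - e\<close> that by blast
qed

lemma perms_crossed_eq:
  assumes "1 \<le> d" "1 \<le> e"
  shows "perms (crossed d e) {1..n} = (\<lambda>(l, \<alpha>, \<beta>). \<alpha> @ (n - e) # \<beta>) `
    (SIGMA l:{..<n - e}. perms (tented d e) ({l + 1..n} - {n - e}) \<times> perms good {1..l})"
  (is "?L = ?R")
proof (intro Set.set_eqI iffI)
  fix \<pi> assume "\<pi> \<in> ?L"
  then obtain l \<pi>' L where "l < n - e" "\<pi> = \<pi>' @ (n - e) # L"
    "\<pi>' \<in> perms (tented d e) ({l + 1..n} - {n - e})" "L \<in> perms good {1..l}"
    by (rule crossed_split[OF _ assms])
  then show "\<pi> \<in> ?R"
    by (intro image_eqI[where x = "(l, \<pi>', L)"]) auto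
next
  fix \<pi> assume "\<pi> \<in> ?R"
  then obtain l \<alpha> \<beta> where "l < n - e" "\<pi> = \<alpha> @ (n - e) # \<beta>"
    "\<alpha> \<in> perms (tented d e) ({l + 1..n} - {n - e})" "\<beta> \<in> perms good {1..l}"
    by (auto simp only: image_iff mem_Sigma_iff lessThan_iff mem_Times_iff split_beta Bex_def split_paired_Ex fst_conv snd_conv)
  then show "\<pi> \<in> ?L"
    by (simp only: crossed_join)
qed

lemma count_eq_0_if_length:
  assumes "\<And>\<pi>. Q \<pi> \<Longrightarrow> k \<le> length \<pi>" "n < k"
  shows "count Q n = 0"
proof -
  have "\<pi> \<notin> perms Q {1..n}" for \<pi>
    using assms distinct_card[of \<pi>] by (force simp: mem_perms_iff)
  then have "perms Q {1..n} = {}" by blast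
  then show ?thesis by (simp add: count_def)
qed

lemma tented_length: "tented d e \<pi> \<Longrightarrow> d + e \<le> length \<pi>"
  by (auto simp: tented_def)

lemma crossed_imp_tented: "crossed d e \<pi> \<Longrightarrow> tented d e \<pi>"
  unfolding crossed_def tented_def by blast

lemma count_crossed:
  assumes "1 \<le> d" "1 \<le> e"
  shows "count (crossed d e) n = (\<Sum>l<n. count (tented d e) (n - 1 - l) * count good l)"
proof -
  have "count (crossed d e) n =
      (\<Sum>l<n - e. card (perms (tented d e) ({l + 1..n} - {n - e})) * card (perms good {1..l}))"
    unfolding count_def perms_crossed_eq[OF assms] by (rule card_join_perms) auto
  also have "\<dots> = (\<Sum>l<n - e. count (tented d e) (n - 1 - l) * count good l)"
  proof (rule sum.cong)
    fix l assume "l \<in> {..<n - e}"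
    then have "card ({l + 1..n} - {n - e}) = n - 1 - l"
      by (subst card_Diff_subset) auto
    then show "card (perms (tented d e) ({l + 1..n} - {n - e})) * card (perms good {1..l}) =
      count (tented d e) (n - 1 - l) * count good l"
      using card_perms[OF order_invariant_tented, of "{l + 1..n} - {n - e}"] by (simp add: count_def)
  qed simp
  \<comment> \<open>For l \<ge> n - e fewer than e entries remain, too few for a tented permutation.
    Adding these zero terms makes the sum a full convolution.\<close>
  also have "\<dots> = (\<Sum>l<n. count (tented d e) (n - 1 - l) * count good l)"
  proof (rule sum.mono_neutral_left)
    show "\<forall>l\<in>{..<n} - {..<n - e}. count (tented d e) (n - 1 - l) * count good l = 0"
      using assms by (auto simp: count_eq_0_if_length[OF tented_length])
  qed auto
  finally show ?thesis .
qed

text \<open>By \<open>crossing_above\<close>, D exceeds \<beta> entrywise here. So D and E are fixed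
  intervals in a fixed order, and only \<beta> is free; this is the source of the term x^(d+e)
  F.\<close>

lemma perms_tented_not_crossed:
  assumes de: "1 \<le> d" "1 \<le> e" "d + e \<le> n"
  defines "D \<equiv> rev [n - e - d + 1..<n - e + 1]" and "E \<equiv> [n - e + 1..<n + 1]"
  shows "perms (tented d e) {1..n} - perms (crossed d e) {1..n} =
    (\<lambda>\<beta>. D @ E @ \<beta>) ` perms good {1..n - d - e}"
proof (intro Set.set_eqI iffI)
  have DE: "set D = {n - e - d + 1..n - e}" "set E = {n - e + 1..n}" "length D = d" "length E = e"
    "distinct D" "distinct E" "sorted_wrt (>) D" "sorted_wrt (<) E"
    using de by (auto simp: D_def E_def sorted_wrt_rev simp del: upt_Suc)
  fix \<pi>
  {
    assume "\<pi> \<in> perms (tented d e) {1..n} - perms (crossed d e) {1..n}"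
    then have set\<pi>: "set \<pi> = {1..n}" and dist: "distinct \<pi>" and "tented d e \<pi>" "\<not> crossed d e \<pi>"
      by (auto simp: mem_perms_iff)
    then obtain D' E' \<beta> where *: "good \<pi>" "\<pi> = D' @ E' @ \<beta>" "length D' = d" "length E' = e" "tent D' E' \<beta>"
      by (auto simp: tented_def)
    have top: "e \<le> n" "{n - e + 1..n} \<subseteq> {1..n}" "{1..n} \<subseteq> {..n}"
      using de by auto
    have E': "set E' = {n - e + 1..n}" and DB: "set D' \<union> set \<beta> = {1..n} - {n - e + 1..n}"
      using tent_top[OF set\<pi>[unfolded *(2)] dist[unfolded *(2)] *(5), unfolded *(4), OF top] .
    have "E' \<noteq> []"
      using *(4) de by auto
    have less: "y < x" if "x \<in> set D'" "y \<in> set \<beta>" for x y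
    proof (rule ccontr)
      assume "\<not> y < x"
      moreover have "x \<noteq> y"
        using that dist by (auto simp: *(2))
      ultimately have "x < y" by simp
      note above = crossing_above[OF *(1)[unfolded *(2)] dist[unfolded *(2)] *(5) \<open>E' \<noteq> []\<close> that this]
      have "crossed d e \<pi>"
        using crossedI[OF *(1)[unfolded *(2)] *(5) that(2) above] *(2-4) by simp
      with \<open>\<not> crossed d e \<pi>\<close> show False by blast
    qed
    have U: "set D' \<union> set \<beta> = {n - e - d + 1..n - e} \<union> {1..n - d - e}"
      unfolding DB using de by auto
    have c: "card (set D') = card {n - e - d + 1..n - e}"
      using dist *(3) de by (simp add: *(2) distinct_card)
    have D': "set D' = {n - e - d + 1..n - e}" and \<beta>: "set \<beta> = {1..n - d - e}"
      by (rule top_part_unique[OF U _ _ c less]; auto)+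
    have "rev D' = rev D"
      by (rule strict_sorted_equal) (use *(5) DE D' in \<open>simp_all add: tent_def sorted_wrt_rev\<close>)
    moreover have "E' = E"
      by (rule strict_sorted_equal) (use *(5) DE E' in \<open>simp_all add: tent_def\<close>)
    moreover have "subseq \<beta> ((D' @ E') @ \<beta>)"
      by (rule subseq_drop_many) simp
    then have "good \<beta>"
      using good_subseq[OF *(1)] by (simp add: *(2))
    then have "\<beta> \<in> perms good {1..n - d - e}"
      using \<beta> dist by (simp add: mem_perms_iff *(2))
    ultimately show "\<pi> \<in> (\<lambda>\<beta>. D @ E @ \<beta>) ` perms good {1..n - d - e}"
      using *(2) by auto
  }
  {
    assume "\<pi> \<in> (\<lambda>\<beta>. D @ E @ \<beta>) ` perms good {1..n - d - e}"
    then obtain \<beta> where \<pi>: "\<pi> = D @ E @ \<beta>" and \<beta>: "set \<beta> = {1..n - d - e}" "distinct \<beta>" "good \<beta>"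
      by (auto simp: mem_perms_iff)
    have DE_tent: "tent D E \<beta>" "tent D E []"
      using DE \<beta>(1) de by (auto simp: tent_def)
    have less: "y < x" if "x \<in> set (D @ E)" "y \<in> set \<beta>" for x y
      using that DE \<beta>(1) by auto
    have "good ((D @ E) @ \<beta>)"
      using good_append_skew[OF good_desc_asc[OF DE_tent(2)] \<beta>(3)] less by blast
    then have "tented d e \<pi>"
      using tentedI[OF _ DE_tent(1)] DE(3,4) \<pi> by simp
    moreover have "\<not> crossed d e \<pi>"
    proof
      assume "crossed d e \<pi>"
      then obtain D' E' \<beta>' y where *: "\<pi> = D' @ E' @ \<beta>'" "length D' = d" "length E' = e"
        "y \<in> set \<beta>'" "\<forall>x\<in>set D'. x < y"
        by (auto simp: crossed_def)
      then have "D' = D" "\<beta>' = \<beta>"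
        using \<pi> DE(3,4) by simp_all
      moreover obtain x where "x \<in> set D"
        using DE(3) de by (cases D) auto
      ultimately show False
        using *(4) bspec[OF *(5), of x] less[of x y] by simp
    qed
    moreover have "set \<pi> = {1..n}"
      unfolding \<pi> set_append DE(1,2) \<beta>(1) using de by auto
    moreover have "distinct \<pi>"
      unfolding \<pi> distinct_append set_append DE(1,2) \<beta>(1) using \<beta>(2) DE(5,6) de by auto
    ultimately show "\<pi> \<in> perms (tented d e) {1..n} - perms (crossed d e) {1..n}"
      by (simp add: mem_perms_iff)
  }
qed

text \<open>The case distinction guards against truncated subtraction: for n < d + e the number n -
  d - e would be 0 and contribute the empty permutation.\<close>

lemma count_tented:
  assumes "1 \<le> d" "1 \<le> e"
  shows "count (tented d e) n = count (crossed d e) n + (if d + e \<le> n then count good (n - d - e) else 0)"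
proof (cases "d + e \<le> n")
  case True
  have "perms (crossed d e) {1..n} \<subseteq> perms (tented d e) {1..n}"
    by (auto simp: mem_perms_iff crossed_imp_tented)
  then have "card (perms (tented d e) {1..n}) = card (perms (crossed d e) {1..n}) +
      card (perms (tented d e) {1..n} - perms (crossed d e) {1..n})"
    by (metis card_Diff_subset card_mono finite_perms le_add_diff_inverse)
  moreover have "card (perms (tented d e) {1..n} - perms (crossed d e) {1..n}) = count good (n - d - e)"
    unfolding perms_tented_not_crossed[OF assms True] count_def
    by (rule card_image) (simp add: inj_on_def)
  ultimately show ?thesis
    using True by (simp add: count_def)
next
  case False
  then show ?thesis
    using count_eq_0_if_length[OF tented_length] count_eq_0_if_length[OF tented_length[OF crossed_imp_tented]]
    by simp
qed

section \<open>Uniqueness of d and e, and the recursion for all avoiders\<close>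

text \<open>The last entry of E is the largest of all, so E must end at n.\<close>

lemma tent_max_split:
  assumes eq: "D @ E @ \<beta> = \<alpha> @ n # \<beta>'" and tent: "tent D E \<beta>" and "E \<noteq> []"
    and n: "\<And>x. x \<in> set \<alpha> \<union> set \<beta>' \<Longrightarrow> x < n"
  shows "D @ E = \<alpha> @ [n]" "\<beta> = \<beta>'"
proof -
  obtain C m where E: "E = C @ [m]"
    using \<open>E \<noteq> []\<close> by (metis append_butlast_last_id)
  have le: "x \<le> m" if "x \<in> set (D @ E @ \<beta>)" for x
    using tent that unfolding tent_def E by (auto simp: sorted_wrt_append intro: less_imp_le)
  have "n \<le> m"
    using le[of n] unfolding eq by simp
  moreover have "m \<in> set (\<alpha> @ n # \<beta>')"
    unfolding eq[symmetric] E by simp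
  ultimately have "m = n"
    using n[of m] by auto
  have "n \<notin> set \<alpha>" "n \<notin> set \<beta>'"
    using n by blast+
  moreover have "(D @ C) @ n # \<beta> = \<alpha> @ n # \<beta>'"
    using eq E \<open>m = n\<close> by simp
  ultimately have "D @ C = \<alpha> \<and> \<beta> = \<beta>'"
    using append_Cons_eq_iff[of n \<alpha> \<beta>' "D @ C" \<beta>] by metis
  then show "D @ E = \<alpha> @ [n]" "\<beta> = \<beta>'"
    using E \<open>m = n\<close> by auto
qed

text \<open>A longer D' would contain the ascent from the last entry of D to the first of E, but D'
  decreases. Used in both directions, this fixes the place of the valley.\<close>

lemma tent_valley_le:
  assumes "D @ E = D' @ E'" "tent D E \<beta>" "tent D' E' \<beta>'" "D \<noteq> []" "E \<noteq> []"
  shows "length D' \<le> length D"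
proof (rule ccontr)
  assume *: "\<not> length D' \<le> length D"
  obtain D1 x where D: "D = D1 @ [x]"
    using \<open>D \<noteq> []\<close> by (metis append_butlast_last_id)
  obtain y E1 where E: "E = y # E1"
    using \<open>E \<noteq> []\<close> by (cases E) auto
  have "x < y"
    using assms(2) by (simp add: tent_def D E)
  have "take (length D') (D @ E) = D'"
    unfolding assms(1) by simp
  moreover have "take (length D') (D @ E) = D1 @ x # y # take (length D' - length D - 1) E1"
    using * by (simp add: D E take_Cons')
  ultimately have "D' = D1 @ x # y # take (length D' - length D - 1) E1"
    by simp
  moreover have "sorted_wrt (>) D'"
    using assms(3) by (simp add: tent_def)
  ultimately have "sorted_wrt (>) (D1 @ x # y # take (length D' - length D - 1) E1)"
    by simp
  then show False
    using \<open>x < y\<close> by (simp add: sorted_wrt_append)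
qed

text \<open>The position of n determines d + e, and the valley before it determines d.\<close>

lemma crossed_unique:
  assumes "\<pi> \<in> perms (crossed d e) {1..n}" "\<pi> \<in> perms (crossed d' e') {1..n}"
    "1 \<le> d" "1 \<le> e" "1 \<le> d'" "1 \<le> e'"
  shows "d = d' \<and> e = e'"
proof -
  have "distinct \<pi>" "set \<pi> = {1..n}"
    using assms(1) by (auto simp: mem_perms_iff)
  obtain D E \<beta> where 1: "\<pi> = D @ E @ \<beta>" "length D = d" "length E = e" "tent D E \<beta>"
    using assms(1) by (auto simp: crossed_def mem_perms_iff)
  obtain D' E' \<beta>' where 2: "\<pi> = D' @ E' @ \<beta>'" "length D' = d'" "length E' = e'" "tent D' E' \<beta>'"
    using assms(2) by (auto simp: crossed_def mem_perms_iff)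
  have ne: "D \<noteq> []" "E \<noteq> []" "D' \<noteq> []" "E' \<noteq> []"
    using 1 2 assms(3-6) by auto
  then have "1 \<le> n"
    using 1(1) \<open>set \<pi> = {1..n}\<close> by (cases "n = 0") auto
  then obtain \<alpha> \<gamma> where \<pi>: "\<pi> = \<alpha> @ n # \<gamma>"
    using \<open>set \<pi> = {1..n}\<close> by (metis atLeastAtMost_iff order_refl split_list)
  have max: "x < n" if "x \<in> set \<alpha> \<union> set \<gamma>" for x
  proof -
    have "x \<noteq> n" "x \<in> set \<pi>"
      using that \<open>distinct \<pi>\<close> by (auto simp: \<pi>)
    then show ?thesis
      unfolding \<open>set \<pi> = {1..n}\<close> by simp
  qed
  have "D @ E = \<alpha> @ [n]"
    by (rule tent_max_split[OF _ 1(4) ne(2) max]) (simp add: 1(1)[symmetric] \<pi>)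
  moreover have "D' @ E' = \<alpha> @ [n]"
    by (rule tent_max_split[OF _ 2(4) ne(4) max]) (simp add: 2(1)[symmetric] \<pi>)
  ultimately have eq: "D @ E = D' @ E'" by simp
  then have "length D = length D'"
    using tent_valley_le[OF eq 1(4) 2(4) ne(1,2)] tent_valley_le[OF eq[symmetric] 2(4) 1(4) ne(3,4)] by simp
  moreover have "length D + length E = length D' + length E'"
    using arg_cong[OF eq, of length] by simp
  ultimately show ?thesis
    using 1(2,3) 2(2,3) by simp
qed

text \<open>The first set collects the avoiders in which all entries before n exceed all entries
  after it, the union those with some a before n and a larger b after it.\<close>

lemma perms_good_eq:
  assumes "1 \<le> n"
  shows "perms good {1..n} =
    (\<lambda>(l, \<alpha>, \<beta>). \<alpha> @ n # \<beta>) ` (SIGMA l:{..<n}. perms good {l + 1..n - 1} \<times> perms good {1..l}) \<union>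
    (\<Union>(d, e) \<in> (SIGMA d:{1..n}. {1..n - d}). perms (crossed d e) {1..n})"
  (is "_ = ?J \<union> ?C")
proof (intro Set.set_eqI iffI)
  fix \<pi> assume "\<pi> \<in> perms good {1..n}"
  then have set\<pi>: "set \<pi> = {1..n}" and dist: "distinct \<pi>" and good: "good \<pi>"
    by (auto simp: mem_perms_iff)
  obtain \<alpha> \<beta> where \<pi>: "\<pi> = \<alpha> @ n # \<beta>"
    using set\<pi> assms by (metis atLeastAtMost_iff order_refl split_list)
  have max: "x < n" if "x \<in> set \<alpha> \<union> set \<beta>" for x
  proof -
    have "x \<noteq> n" "x \<in> set \<pi>"
      using that dist by (auto simp: \<pi>)
    then show ?thesis
      unfolding set\<pi> by simp
  qed
  show "\<pi> \<in> ?J \<union> ?C"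
  proof (cases "\<exists>a\<in>set \<alpha>. \<exists>b\<in>set \<beta>. a < b")
    case True
    then obtain a b where "a \<in> set \<alpha>" "b \<in> set \<beta>" "a < b" by blast
    then obtain d e where de: "1 \<le> d" "1 \<le> e" "d + e \<le> length \<pi>" "crossed d e \<pi>"
      using good_crossing_decomposition[OF good[unfolded \<pi>] dist[unfolded \<pi>] max] unfolding \<pi> by metis
    moreover have "length \<pi> = n"
      using distinct_card[OF dist] by (simp add: set\<pi>)
    ultimately have "\<pi> \<in> perms (crossed d e) {1..n}" "(d, e) \<in> (SIGMA d:{1..n}. {1..n - d})"
      using set\<pi> dist by (auto simp: mem_perms_iff)
    then show ?thesis by blast
  next
    case False
    define l where "l = length \<beta>"
    have less: "y < x" if "x \<in> set \<alpha>" "y \<in> set \<beta>" for x y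
    proof -
      have "x \<noteq> y"
        using that dist by (auto simp: \<pi>)
      then show ?thesis
        using that False by (meson linorder_neqE_nat)
    qed
    have "length \<pi> = n"
      using distinct_card[OF dist] by (simp add: set\<pi>)
    then have len: "length \<alpha> + l = n - 1"
      by (simp add: \<pi> l_def)
    have "set \<alpha> \<union> set \<beta> = {1..n} - {n}"
      using set\<pi> dist by (auto simp: \<pi>)
    also have "\<dots> = {l + 1..n - 1} \<union> {1..l}"
      using len assms by auto
    finally have U: "set \<alpha> \<union> set \<beta> = {l + 1..n - 1} \<union> {1..l}" .
    have c: "card (set \<alpha>) = card {l + 1..n - 1}"
      using dist len by (simp add: \<pi> distinct_card)
    have \<alpha>: "set \<alpha> = {l + 1..n - 1}" and \<beta>: "set \<beta> = {1..l}"
      by (rule top_part_unique[OF U _ _ c less]; auto)+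
    have "subseq \<alpha> (\<alpha> @ n # \<beta>)" "subseq \<beta> ((\<alpha> @ [n]) @ \<beta>)"
      by (intro subseq_rev_drop_many subseq_drop_many subseq_order.order_refl)+
    then have "good \<alpha>" "good \<beta>"
      using good_subseq[OF good] by (simp_all add: \<pi>)
    then have "\<alpha> \<in> perms good {l + 1..n - 1}" "\<beta> \<in> perms good {1..l}" "l < n"
      using \<alpha> \<beta> dist len assms by (auto simp: mem_perms_iff \<pi>)
    then have "\<pi> \<in> ?J"
      by (intro image_eqI[where x = "(l, \<alpha>, \<beta>)"]) (auto simp: \<pi>)
    then show ?thesis by blast
  qed
next
  fix \<pi> assume "\<pi> \<in> ?J \<union> ?C"
  then show "\<pi> \<in> perms good {1..n}"
  proof
    assume "\<pi> \<in> ?J"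
    then obtain l \<alpha> \<beta> where l: "l < n" and \<pi>: "\<pi> = \<alpha> @ n # \<beta>"
      and \<alpha>: "set \<alpha> = {l + 1..n - 1}" "distinct \<alpha>" "good \<alpha>"
      and \<beta>: "set \<beta> = {1..l}" "distinct \<beta>" "good \<beta>"
      by (auto simp: mem_perms_iff)
    have "good (\<alpha> @ [n])"
      by (rule good_snoc_max[OF \<alpha>(3)]) (use l \<alpha> in auto)
    moreover have "y < x" if "x \<in> set (\<alpha> @ [n])" "y \<in> set \<beta>" for x y
      using that \<alpha>(1) \<beta>(1) l by auto
    ultimately have "good ((\<alpha> @ [n]) @ \<beta>)"
      using good_append_skew \<beta>(3) by blast
    moreover have "set \<pi> = {1..n}" "distinct \<pi>"
      using \<alpha> \<beta> l by (auto simp: \<pi>)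
    ultimately show ?thesis
      by (simp add: mem_perms_iff \<pi>)
  next
    assume "\<pi> \<in> ?C"
    then show ?thesis
      by (auto simp: mem_perms_iff crossed_def)
  qed
qed

lemma count_good:
  assumes "1 \<le> n"
  shows "count good n = (\<Sum>l<n. count good (n - 1 - l) * count good l) +
    (\<Sum>d=1..n. \<Sum>e=1..n - d. count (crossed d e) n)"
proof -
  let ?J = "(\<lambda>(l, \<alpha>, \<beta>). \<alpha> @ n # \<beta>) ` (SIGMA l:{..<n}. perms good {l + 1..n - 1} \<times> perms good {1..l})"
  let ?S = "SIGMA d:{1..n}. {1..n - d}"
  let ?C = "\<Union>(d, e) \<in> ?S. perms (crossed d e) {1..n}"
  have "finite (?J \<union> ?C)"
    unfolding perms_good_eq[OF assms, symmetric] by (rule finite_perms)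
  then have fin: "finite ?J" "finite ?C"
    unfolding finite_Un by (rule conjunct1, rule conjunct2)
  \<comment> \<open>In a crossed permutation an entry x of D precedes n and is smaller than some y
    after n, which is impossible in \<open>?J\<close>.\<close>
  have "?J \<inter> ?C = {}"
  proof (rule ccontr)
    assume "?J \<inter> ?C \<noteq> {}"
    then obtain \<pi> where "\<pi> \<in> ?J" "\<pi> \<in> ?C" by blast
    from this(1) obtain l \<alpha> \<beta> where l: "l < n" and \<pi>: "\<pi> = \<alpha> @ n # \<beta>"
      and \<alpha>: "set \<alpha> = {l + 1..n - 1}" and \<beta>: "set \<beta> = {1..l}"
      by (auto simp: mem_perms_iff)
    from \<open>\<pi> \<in> ?C\<close> obtain d e where c: "crossed d e \<pi>" "1 \<le> d" "1 \<le> e"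
      by (auto simp: mem_perms_iff)
    obtain D E \<beta>' y where *: "\<pi> = D @ E @ \<beta>'" "length D = d" "length E = e" "tent D E \<beta>'"
      "y \<in> set \<beta>'" "\<forall>x\<in>set D. x < y"
      using c(1) by (auto simp: crossed_def)
    have ne: "E \<noteq> []" using *(3) c(3) by auto
    obtain x where x: "x \<in> set D"
      using *(2) c(2) by (cases D) auto
    have max: "z < n" if "z \<in> set \<alpha> \<union> set \<beta>" for z
      using that l unfolding \<alpha> \<beta> by auto
    have "D @ E = \<alpha> @ [n]" "\<beta>' = \<beta>"
      by (rule tent_max_split[OF _ *(4) ne max]; simp add: *(1)[symmetric] \<pi>)+
    then have "x \<in> set (\<alpha> @ [n])" "y \<in> set \<beta>"
      using x *(5) by (metis Un_iff set_append, simp)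
    moreover have "x < y"
      using *(6) x by blast
    ultimately show False
      using \<alpha> \<beta> l by auto
  qed
  then have "count good n = card ?J + card ?C"
    unfolding count_def perms_good_eq[OF assms] using fin by (rule card_Un_disjoint[rotated 2])
  also have "card ?J = (\<Sum>l<n. card (perms good {l + 1..n - 1}) * card (perms good {1..l}))"
    by (rule card_join_perms) auto
  also have "\<dots> = (\<Sum>l<n. count good (n - 1 - l) * count good l)"
    by (rule sum.cong) (simp_all add: card_perms[OF order_invariant_good])
  also have "card ?C = (\<Sum>p\<in>?S. card (case p of (d, e) \<Rightarrow> perms (crossed d e) {1..n}))"
  proof (rule card_UN_disjoint; (intro ballI impI)?)
    fix p q assume pq: "p \<in> ?S" "q \<in> ?S" "p \<noteq> q"
    obtain d e d' e' where [simp]: "p = (d, e)" "q = (d', e')"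
      by (cases p, cases q)
    have "1 \<le> d" "1 \<le> e" "1 \<le> d'" "1 \<le> e'"
      using pq by auto
    then have False if "\<pi> \<in> perms (crossed d e) {1..n}" "\<pi> \<in> perms (crossed d' e') {1..n}" for \<pi>
      using crossed_unique[OF that] pq(3) by simp
    then show "(case p of (d, e) \<Rightarrow> perms (crossed d e) {1..n}) \<inter>
        (case q of (d, e) \<Rightarrow> perms (crossed d e) {1..n}) = {}"
      unfolding \<open>p = (d, e)\<close> \<open>q = (d', e')\<close> prod.case by blast
  qed (auto split: prod.splits)
  also have "\<dots> = (\<Sum>(d, e)\<in>?S. count (crossed d e) n)"
    by (intro sum.cong) (auto simp: count_def)
  also have "\<dots> = (\<Sum>d=1..n. \<Sum>e=1..n - d. count (crossed d e) n)"
    by (rule sum.Sigma[symmetric]) auto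
  finally show ?thesis .
qed

section \<open>Generating functions\<close>

definition count_fps :: "(nat list \<Rightarrow> bool) \<Rightarrow> rat fps" where
  "count_fps Q = Abs_fps (\<lambda>n. of_nat (count Q n))"

lemma count_fps_nth [simp]: "fps_nth (count_fps Q) n = of_nat (count Q n)"
  by (simp add: count_fps_def)

text \<open>The factor \<open>fps_X\<close> accounts for the separating entry; at n = 0 both sides
  vanish.\<close>

lemma fps_X_mult_count_fps_nth:
  "fps_nth (fps_X * (count_fps Q * count_fps P)) n = of_nat (\<Sum>l<n. count P (n - 1 - l) * count Q l)"
proof (cases n)
  case (Suc m)
  have "fps_nth (fps_X * (count_fps Q * count_fps P)) n = fps_nth (count_fps Q * count_fps P) m"
    by (simp add: Suc)
  also have "\<dots> = (\<Sum>l\<le>m. of_nat (count Q l) * of_nat (count P (m - l)))"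
    by (simp add: fps_mult_nth atLeast0AtMost)
  finally show ?thesis
    by (simp add: Suc lessThan_Suc_atMost mult.commute)
qed simp

lemma count_fps_crossed:
  assumes "1 \<le> d" "1 \<le> e"
  shows "count_fps (crossed d e) = fps_X * (count_fps good * count_fps (tented d e))"
  by (rule fps_ext) (simp only: fps_X_mult_count_fps_nth count_fps_nth count_crossed[OF assms])

lemma count_fps_tented:
  assumes "1 \<le> d" "1 \<le> e"
  shows "count_fps (tented d e) = count_fps (crossed d e) + fps_X ^ (d + e) * count_fps good"
  by (rule fps_ext) (simp add: fps_X_power_mult_nth count_tented[OF assms])

text \<open>The first factor is x/(1 - x), so multiplying by it sums over all positive shifts.
  Applied twice it produces the double sum over d and e.\<close>

lemma fps_shifted_sum_nth:
  "fps_nth (Abs_fps (\<lambda>k. if k = 0 then 0 else 1) * A) n = (\<Sum>i=1..n. fps_nth A (n - i))"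
  for A :: "'a :: comm_ring_1 fps"
proof -
  have "(\<Sum>i=0..n. (if i = 0 then 0 else 1) * fps_nth A (n - i)) = (\<Sum>i=1..n. fps_nth A (n - i))"
    by (rule sum.mono_neutral_cong_right) auto
  then show ?thesis
    by (simp add: fps_mult_nth)
qed

lemma fps_shifted_geometric:
  "Abs_fps (\<lambda>k. if k = 0 then 0 else 1) * (1 - fps_X) = (fps_X :: 'a :: comm_ring_1 fps)"
  by (rule fps_ext) (auto simp: right_diff_distrib mult.commute[of _ fps_X])

lemma count_fps_good:
  fixes F G :: "rat fps"
  defines "F \<equiv> count_fps good" and "G \<equiv> Abs_fps (\<lambda>k. if k = 0 then 0 else 1)"
  shows "F = 1 - fps_X * F + fps_X * (2 + G ^ 2) * F ^ 2 - fps_X ^ 2 * F ^ 3"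
proof -
  \<comment> \<open>The solution of C = x F (C + x^(d+e) F) is C = x^(d+e) P. The divisor 1 - x F
    has constant term 1 and is thus invertible.\<close>
  define P where "P = fps_X * F ^ 2 * inverse (1 - fps_X * F)"
  have unit: "inverse (1 - fps_X * F) * (1 - fps_X * F) = 1"
    by (rule inverse_mult_eq_1) simp
  then have nonzero: "1 - fps_X * F \<noteq> 0"
    by auto
  have P: "P * (1 - fps_X * F) = fps_X * F ^ 2"
    unfolding P_def mult.assoc unit by simp
  have crossed: "count_fps (crossed d e) = fps_X ^ (d + e) * P" if "1 \<le> d" "1 \<le> e" for d e
  proof -
    let ?C = "count_fps (crossed d e)"
    have "?C * (1 - fps_X * F) = ?C - fps_X * (F * ?C)"
      by (simp add: algebra_simps)
    also have "\<dots> = fps_X * (F * (?C + fps_X ^ (d + e) * F)) - fps_X * (F * ?C)"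
      using count_fps_crossed[OF that, unfolded count_fps_tented[OF that]]
      unfolding F_def by (rule arg_cong)
    also have "\<dots> = fps_X ^ (d + e) * (fps_X * F ^ 2)"
      by (simp add: algebra_simps power2_eq_square)
    also have "\<dots> = fps_X ^ (d + e) * P * (1 - fps_X * F)"
      by (simp only: P mult.assoc)
    finally show ?thesis
      using mult_right_cancel[OF nonzero] by blast
  qed
  have "F = 1 + fps_X * F ^ 2 + G * (G * P)"
  proof (rule fps_ext)
    fix n
    show "fps_nth F n = fps_nth (1 + fps_X * F ^ 2 + G * (G * P)) n"
    \<comment> \<open>The recursion \<open>count_good\<close> starts at n = 1; the summand 1 is the
      empty permutation.\<close>
    proof (cases "n = 0")
      case True
      have "perms good {} = {[]}"
        by (auto simp: mem_perms_iff good_def)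
      then show ?thesis
        using True by (simp add: F_def G_def count_def)
    next
      case False
      have "fps_nth (G * (G * P)) n = (\<Sum>d=1..n. \<Sum>e=1..n - d. fps_nth P (n - d - e))"
        by (simp only: G_def fps_shifted_sum_nth)
      also have "\<dots> = (\<Sum>d=1..n. \<Sum>e=1..n - d. of_nat (count (crossed d e) n))"
      proof (intro sum.cong refl)
        fix d e assume "d \<in> {1..n}" "e \<in> {1..n - d}"
        then have "1 \<le> d" "1 \<le> e" "d + e \<le> n" by auto
        \<comment> \<open>As d + e \<le> n, the factor x^(d+e) is an honest shift of
          coefficients.\<close>
        then show "fps_nth P (n - d - e) = of_nat (count (crossed d e) n)"
          using crossed[of d e] by (simp add: fps_X_power_mult_nth flip: count_fps_nth)
      qed
      finally show ?thesis
        using False count_good[of n] fps_X_mult_count_fps_nth[of good good n]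
        by (simp add: F_def power2_eq_square)
    qed
  qed
  then have "F - 1 - fps_X * F ^ 2 = G ^ 2 * P"
    by (simp add: power2_eq_square algebra_simps)
  \<comment> \<open>Multiplication by 1 - x F clears the denominator in P; expanding the product
    gives the cubic equation.\<close>
  then have "(F - 1 - fps_X * F ^ 2) * (1 - fps_X * F) = G ^ 2 * (fps_X * F ^ 2)"
    by (simp only: P mult.assoc)
  then show ?thesis
    by (simp add: algebra_simps power2_eq_square power3_eq_cube)
qed

theorem theorem3p30:
  fixes T :: "nat list set" and F :: "rat fps"
  assumes "T = {[3,1,4,2], [1,4,3,2], [1,2,4,3]}"
    and "F = avoiders_gf T"
  shows "F = 1 - fps_X * F + fps_X * (2 + fps_X^2 / (1 - fps_X)^2) * F^2 - fps_X^2 * F^3"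
proof -
  define G :: "rat fps" where "G = Abs_fps (\<lambda>k. if k = 0 then 0 else 1)"
  have "F = count_fps good"
    unfolding assms avoiders_gf_def count_fps_def count_def perms_def avoiders_def good_iff_avoids ..
  moreover have "fps_X ^ 2 / (1 - fps_X) ^ 2 = G ^ 2"
  proof -
    have "(1 - fps_X :: rat fps) \<noteq> 0"
      using fps_X_neq_one by (metis right_minus_eq)
    \<comment> \<open>The quotient in the statement is resolved by exact division: G (1 - x) = x,
      and 1 - x is nonzero.\<close>
    moreover have "fps_X ^ 2 = G ^ 2 * (1 - fps_X) ^ 2"
      unfolding power_mult_distrib[symmetric] G_def fps_shifted_geometric ..
    ultimately show ?thesis
      by (metis nonzero_mult_div_cancel_right power_not_zero)
  qed
  ultimately show ?thesis
    using count_fps_good by (simp only: G_def)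
qed

end
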